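(* Let $a,b,c\in\mathbb{Z}$, let $F(n) = a n^2 + b n + c$, let $m \ge 0$, and let $x_1,\dots,x_m \in \mathbb{Z}$. Define matrices $A_k = \begin{pmatrix}\alpha_k & \beta_k\\ \gamma_k & \delta_k\end{pmatrix}$ recursively by $$A_0 = \begin{pmatrix}1&0\\0&1\end{pmatrix}, \qquad A_{k+1} = A_k + x_{k+1} B_k \quad (0 \le k \le m-1),$$ where $$B_k = \begin{pmatrix} a\,\gamma_k & \delta_k \\ 0 & 0\end{pmatrix} \text{ for odd } k, \qquad B_k = \begin{pmatrix} 0 & 0\\ \alpha_k & a\,\beta_k\end{pmatrix} \text{ for even } k.$$ Then $A_m \in \Gamma_a$ and $$f_m(x_1,\dots,x_m) = \phi_m[A_m].$$
   Context: For $A=\begin{pmatrix}\alpha&\beta\\ \gamma&\delta\end{pmatrix}\in M_2(\mathbb{Z})$ put $\Delta[A] = \alpha\delta - a\beta\gamma$, $\phi_0[A] = \alpha^2 + b\,\alpha\beta + ac\,\beta^2$, $\phi_1[A] = a\,\gamma^2 + b\,\gamma\delta + c\,\delta^2$, and for a natural number $m$ let $\phi_m[A]=\phi_0[A]$ if $m$ is even and $\phi_m[A]=\phi_1[A]$ if $m$ is odd. $\Gamma_a = \{A \in M_2(\mathbb{Z}) : \Delta[A]=1\}$. The polynomials $f_m = f_m(x_1,\dots,x_m)\in\mathbb{Z}[x_1,\dots,x_m]$ associated with $F$ are defined by $f_0=1$, $f_1(x_1)=F(x_1)$ and, for $m\ge2$, $$f_m = f_{m-2} + x_m \sum_{j=1}^{2}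 \left(\tfrac{1}{j!}F^{(j)}\right)\!\left(\sum_{k=1}^{m-1} x_k f_{k-1}\right)(x_m f_{m-1})^{j-1},$$ where $F^{(j)}$ is the $j$th derivative of $F$. They satisfy $F\left(\sum_{k=1}^m x_k f_{k-1}\right) = f_{m-1}f_m$ for all $m\ge 1$. *)

theory Defs
  imports
    "HOL-Analysis.Analysis"
    "HOL-Computational_Algebra.Polynomial"
    "HOL-Library.Poly_Mapping"
begin

(* Integer polynomials in variables indexed by nat: a monomial is its finitely supported
   exponent map, a polynomial its finitely supported coefficient map.  With this encoding the
   ring operations provided by Poly_Mapping are those of the polynomial ring. *)
type_synonym int_mpoly = "(nat \<Rightarrow>\<^sub>0 nat) \<Rightarrow>\<^sub>0 int"

definition Var :: "nat \<Rightarrow> int_mpoly" where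
  "Var i = Poly_Mapping.single (Poly_Mapping.single i 1) 1"

definition mpoly_eval :: "(nat \<Rightarrow> int) \<Rightarrow> int_mpoly \<Rightarrow> int" where
  "mpoly_eval x p =
     (\<Sum>t \<in> Poly_Mapping.keys p.
        Poly_Mapping.lookup p t * (\<Prod>i \<in> Poly_Mapping.keys t. x i ^ Poly_Mapping.lookup t i))"

definition subst_mpoly :: "int poly \<Rightarrow> int_mpoly \<Rightarrow> int_mpoly" where
  "subst_mpoly P q = poly (map_poly of_int P) q"

(* The division in "int poly" is exact here: every coefficient of the j-th derivative of an
   integer polynomial is divisible by j!. *)
definition divided_deriv :: "nat \<Rightarrow> int poly \<Rightarrow> int poly" where
  "divided_deriv j F = (pderiv ^^ j) F div fact j"

(* The sum over j stops at 2 since F is meant to have degree at most 2. *)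
fun assoc_mpoly :: "int poly \<Rightarrow> nat \<Rightarrow> int_mpoly" where
  "assoc_mpoly F 0 = 1"
| "assoc_mpoly F (Suc 0) = subst_mpoly F (Var 1)"
| "assoc_mpoly F (Suc (Suc n)) =
     assoc_mpoly F n + Var (n + 2) *
       (\<Sum>j = 1..2. subst_mpoly (divided_deriv j F) (\<Sum>k = 1..n + 1. Var k * assoc_mpoly F (k - 1))
                   * (Var (n + 2) * assoc_mpoly F (n + 1)) ^ (j - 1))"

definition mat2 :: "int \<Rightarrow> int \<Rightarrow> int \<Rightarrow> int \<Rightarrow> int ^ 2 ^ 2" where
  "mat2 \<alpha> \<beta> \<gamma> \<delta> = vector [vector [\<alpha>, \<beta>], vector [\<gamma>, \<delta>]]"

definition Delta :: "int \<Rightarrow> int ^ 2 ^ 2 \<Rightarrow> int" where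
  "Delta a A = A $ 1 $ 1 * A $ 2 $ 2 - a * A $ 1 $ 2 * A $ 2 $ 1"

definition Gamma_set :: "int \<Rightarrow> (int ^ 2 ^ 2) set" where
  "Gamma_set a = {A. Delta a A = 1}"

definition phi0 :: "int \<Rightarrow> int \<Rightarrow> int \<Rightarrow> int ^ 2 ^ 2 \<Rightarrow> int" where
  "phi0 a b c A = (A $ 1 $ 1)\<^sup>2 + b * A $ 1 $ 1 * A $ 1 $ 2 + a * c * (A $ 1 $ 2)\<^sup>2"

definition phi1 :: "int \<Rightarrow> int \<Rightarrow> int \<Rightarrow> int ^ 2 ^ 2 \<Rightarrow> int" where
  "phi1 a b c A = a * (A $ 2 $ 1)\<^sup>2 + b * A $ 2 $ 1 * A $ 2 $ 2 + c * (A $ 2 $ 2)\<^sup>2"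

definition phi :: "int \<Rightarrow> int \<Rightarrow> int \<Rightarrow> nat \<Rightarrow> int ^ 2 ^ 2 \<Rightarrow> int" where
  "phi a b c m A = (if even m then phi0 a b c A else phi1 a b c A)"

definition step_mat :: "int \<Rightarrow> nat \<Rightarrow> int ^ 2 ^ 2 \<Rightarrow> int ^ 2 ^ 2" where
  "step_mat a k A =
     (if odd k then mat2 (a * A $ 2 $ 1) (A $ 2 $ 2) 0 0
      else mat2 0 0 (A $ 1 $ 1) (a * A $ 1 $ 2))"

primrec seq_mat :: "int \<Rightarrow> (nat \<Rightarrow> int) \<Rightarrow> nat \<Rightarrow> int ^ 2 ^ 2" where
  "seq_mat a x 0 = mat2 1 0 0 1"
| "seq_mat a x (Suc k) =
     seq_mat a x k + map_matrix (\<lambda>e. x (Suc k) * e) (step_mat a k (seq_mat a x k))"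

end

theory Submission
  imports Defs
begin

text \<open>
  Evaluation at \<open>x\<close> is a ring homomorphism, so the values \<open>f k\<close> of the associated polynomials
  obey the recurrence
  \<open>f (m + 2) = f m + z * (2 * a * S + b) + a * z\<^sup>2 * f (m + 1)\<close>, where \<open>z = x (m + 2)\<close> and
  \<open>S\<close> is the sum of the \<open>x k * f (k - 1)\<close> for \<open>k \<le> m + 1\<close>.

  The matrices satisfy the same recurrence because of a bilinear form that interpolates between the
  two quadratic forms.  For \<open>m\<close> even, \<open>phi a b c m\<close> depends on the top row \<open>(\<alpha>, \<beta>)\<close> only, for
  \<open>m\<close> odd on the bottom row \<open>(\<gamma>, \<delta>)\<close> only, and a step changes just one row, adding to it \<open>z\<close> times
  the twisted other row.  The bilinear form
  \<open>\<alpha> * \<gamma> + b * \<beta> * \<gamma> + c * \<beta> * \<delta>\<close> grows in step \<open>k\<close> by exactly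
  \<open>x (k + 1) * phi a b c k\<close>, hence, starting from \<open>0\<close> at the identity matrix, it
  equals the sum \<open>S\<close> as long as the \<open>phi a b c k\<close> are the values \<open>f k\<close>.  Expanding the quadratic
  form of the changed row then gives the recurrence: the coefficient of \<open>z\<^sup>2\<close> is \<open>a\<close> times the form
  of the other row, and that of \<open>z\<close> is \<open>2 * a * S + b * (\<alpha> * \<delta> - a * \<beta> * \<gamma>)\<close>, whose
  last factor is the invariant \<open>Delta\<close>, equal to \<open>1\<close>.  Both recurrences start from the
  values \<open>1\<close> and \<open>poly F (x 1)\<close>.
\<close>

section \<open>Evaluation of polynomials as a ring homomorphism\<close>

definition monom_eval :: "(nat \<Rightarrow> int) \<Rightarrow> (nat \<Rightarrow>\<^sub>0 nat) \<Rightarrow> int" where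
  "monom_eval x t = (\<Prod>i \<in> Poly_Mapping.keys t. x i ^ Poly_Mapping.lookup t i)"

text \<open>
  Sums and products of polynomials may lose keys by cancellation; summing over an arbitrary finite
  superset of the keys avoids having to track this.
\<close>

lemma monom_eval_superset:
  assumes "finite I" "Poly_Mapping.keys t \<subseteq> I"
  shows "monom_eval x t = (\<Prod>i\<in>I. x i ^ Poly_Mapping.lookup t i)"
  unfolding monom_eval_def
  by (rule prod.mono_neutral_left) (use assms in \<open>auto simp: in_keys_iff\<close>)

lemma mpoly_eval_superset:
  assumes "finite T" "Poly_Mapping.keys p \<subseteq> T"
  shows "mpoly_eval x p = (\<Sum>t\<in>T. Poly_Mapping.lookup p t * monom_eval x t)"
  unfolding mpoly_eval_def monom_eval_def
  by (rule sum.mono_neutral_left) (use assms in \<open>auto simp: in_keys_iff\<close>)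

lemma monom_eval_add: "monom_eval x (s + t) = monom_eval x s * monom_eval x t"
proof -
  let ?I = "Poly_Mapping.keys s \<union> Poly_Mapping.keys t"
  have "monom_eval x (s + t) = (\<Prod>i\<in>?I. x i ^ Poly_Mapping.lookup (s + t) i)"
    by (rule monom_eval_superset) (use keys_add[of s t] in auto)
  also have "\<dots> = (\<Prod>i\<in>?I. x i ^ Poly_Mapping.lookup s i) * (\<Prod>i\<in>?I. x i ^ Poly_Mapping.lookup t i)"
    by (simp add: lookup_add power_add prod.distrib)
  also have "\<dots> = monom_eval x s * monom_eval x t"
    using monom_eval_superset[of ?I s x] monom_eval_superset[of ?I t x] by simp
  finally show ?thesis .
qed

lemma mpoly_eval_add: "mpoly_eval x (p + q) = mpoly_eval x p + mpoly_eval x q"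
proof -
  let ?T = "Poly_Mapping.keys p \<union> Poly_Mapping.keys q"
  have "mpoly_eval x (p + q) = (\<Sum>t\<in>?T. Poly_Mapping.lookup (p + q) t * monom_eval x t)"
    by (rule mpoly_eval_superset) (use keys_add[of p q] in auto)
  also have "\<dots> = (\<Sum>t\<in>?T. Poly_Mapping.lookup p t * monom_eval x t)
                + (\<Sum>t\<in>?T. Poly_Mapping.lookup q t * monom_eval x t)"
    by (simp add: lookup_add distrib_right sum.distrib)
  also have "\<dots> = mpoly_eval x p + mpoly_eval x q"
    using mpoly_eval_superset[of ?T p x] mpoly_eval_superset[of ?T q x] by simp
  finally show ?thesis .
qed

lemma mpoly_eval_zero: "mpoly_eval x 0 = 0"
  by (simp add: mpoly_eval_def)

lemma mpoly_eval_single: "mpoly_eval x (Poly_Mapping.single t n) = n * monom_eval x t"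
  by (subst mpoly_eval_superset[of "{t}"]) (auto simp: lookup_single)

lemma mpoly_eval_one: "mpoly_eval x 1 = 1"
  by (simp add: mpoly_eval_single monom_eval_def flip: single_one)

lemma mpoly_eval_Var: "mpoly_eval x (Var i) = x i"
  by (simp add: Var_def mpoly_eval_single monom_eval_def)

lemma mpoly_eval_sum: "mpoly_eval x (sum g I) = (\<Sum>i\<in>I. mpoly_eval x (g i))"
  by (induction I rule: infinite_finite_induct) (auto simp: mpoly_eval_zero mpoly_eval_add)

text \<open>
  Both sides are additive in each factor, so only the product of two terms needs to be
  compared, where multiplicativity is that of \<open>monom_eval\<close>.
\<close>

lemma mpoly_eval_mult: "mpoly_eval x (p * q) = mpoly_eval x p * mpoly_eval x q"
proof -
  let ?term = "\<lambda>p t. Poly_Mapping.single t (Poly_Mapping.lookup p t) :: int_mpoly"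
  have decomp: "r = (\<Sum>t\<in>Poly_Mapping.keys r. ?term r t)" for r :: int_mpoly
    by (rule poly_mapping_eqI) (auto simp: lookup_sum lookup_single when_def in_keys_iff)
  have "p * q = (\<Sum>s\<in>Poly_Mapping.keys p. \<Sum>t\<in>Poly_Mapping.keys q. ?term p s * ?term q t)"
    by (subst decomp[of p], subst decomp[of q]) (simp add: sum_product)
  then have "mpoly_eval x (p * q)
      = (\<Sum>s\<in>Poly_Mapping.keys p. \<Sum>t\<in>Poly_Mapping.keys q.
           mpoly_eval x (?term p s) * mpoly_eval x (?term q t))"
    by (simp add: mpoly_eval_sum mult_single mpoly_eval_single monom_eval_add mult_ac)
  also have "\<dots> = mpoly_eval x (\<Sum>s\<in>Poly_Mapping.keys p. ?term p s)
                * mpoly_eval x (\<Sum>t\<in>Poly_Mapping.keys q. ?term q t)"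
    by (simp only: mpoly_eval_sum sum_product)
  finally show ?thesis
    by (simp only: decomp[symmetric])
qed

lemma mpoly_eval_power: "mpoly_eval x (p ^ n) = mpoly_eval x p ^ n"
  by (induction n) (simp_all add: mpoly_eval_one mpoly_eval_mult)

lemma mpoly_eval_of_int: "mpoly_eval x (of_int n) = n"
proof -
  have nat: "mpoly_eval x (of_nat k) = int k" for k
    by (induction k) (simp_all add: mpoly_eval_zero mpoly_eval_one mpoly_eval_add)
  have uminus: "mpoly_eval x (- p) = - mpoly_eval x p" for p
    using mpoly_eval_add[of x p "- p"] by (simp add: mpoly_eval_zero)
  show ?thesis
    by (cases n rule: int_cases2) (simp_all add: nat uminus)
qed

lemma mpoly_eval_subst_mpoly: "mpoly_eval x (subst_mpoly P q) = poly P (mpoly_eval x q)"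
  unfolding subst_mpoly_def
  by (induction P)
    (simp_all add: map_poly_pCons mpoly_eval_zero mpoly_eval_add mpoly_eval_mult mpoly_eval_of_int)

section \<open>The recurrence for a quadratic polynomial\<close>

lemma divided_deriv_1_quadratic: "divided_deriv 1 [:c, b, a:] = [:b, 2 * a:]"
  by (simp add: divided_deriv_def pderiv_pCons)

lemma divided_deriv_2_quadratic: "divided_deriv 2 [:c, b, a:] = [:a:]"
proof -
  have "(pderiv ^^ 2) [:c, b, a:] = [:a:] * fact 2"
    by (simp add: eval_nat_numeral pderiv_pCons numeral_poly[of "Num.Bit0 Num.One"])
  then show ?thesis
    unfolding divided_deriv_def by (simp only:) (rule nonzero_mult_div_cancel_right, simp)
qed

lemma mpoly_eval_assoc_mpoly_Suc_Suc:
  fixes F :: "int poly" and x :: "nat \<Rightarrow> int"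
  defines "f \<equiv> \<lambda>k. mpoly_eval x (assoc_mpoly F k)"
  assumes "F = [:c, b, a:]"
  shows "f (Suc (Suc n)) = f n + x (n + 2) * (2 * a * (\<Sum>k<Suc n. x (Suc k) * f k) + b)
           + a * (x (n + 2))\<^sup>2 * f (Suc n)"
proof -
  have sum: "(\<Sum>k = 1..n + 1. x k * f (k - 1)) = (\<Sum>k<Suc n. x (Suc k) * f k)"
    by (rule sum.reindex_bij_witness[of _ Suc "\<lambda>k. k - 1"]) auto
  have two: "{1..2} = {1, 2 :: nat}"
    by auto
  have "f (Suc (Suc n)) = f n + x (n + 2) * (b + 2 * a * (\<Sum>k = 1..n + 1. x k * f (k - 1))
          + a * (x (n + 2) * f (Suc n)))"
    unfolding assms(2) f_def
    by (simp only: assoc_mpoly.simps two)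
      (simp add: divided_deriv_1_quadratic[unfolded One_nat_def] divided_deriv_2_quadratic
        mpoly_eval_add mpoly_eval_mult mpoly_eval_sum mpoly_eval_Var mpoly_eval_subst_mpoly
        algebra_simps del: sum.cl_ivl_Suc)
  then show ?thesis
    unfolding sum by (simp add: algebra_simps power2_eq_square)
qed

section \<open>The matrix sequence\<close>

lemma mat2_entries [simp]:
  "mat2 p q r s $ 1 $ 1 = p" "mat2 p q r s $ 1 $ 2 = q"
  "mat2 p q r s $ 2 $ 1 = r" "mat2 p q r s $ 2 $ 2 = s"
  by (simp_all add: mat2_def)

lemma seq_mat_Suc_entry:
  "seq_mat a x (Suc k) $ i $ j
     = seq_mat a x k $ i $ j + x (Suc k) * step_mat a k (seq_mat a x k) $ i $ j"
  by (simp add: map_matrix_def)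

lemmas seq_mat_Suc_entries = seq_mat_Suc_entry step_mat_def

text \<open>A step adds to one row a multiple of the vector that pairs to zero with the other row.\<close>

lemma Delta_seq_mat: "Delta a (seq_mat a x m) = 1"
proof (induction m)
  case 0
  show ?case by (simp add: Delta_def)
next
  case (Suc m)
  then show ?case
    by (simp add: Delta_def seq_mat_Suc_entries algebra_simps del: seq_mat.simps)
qed

text \<open>
  A bilinear pairing of the two rows.  Under the substitution
  \<open>(\<alpha>, \<beta>) = (a * \<gamma>, \<delta>)\<close> it becomes \<open>phi1\<close>, and under \<open>(\<gamma>, \<delta>) = (\<alpha>, a * \<beta>)\<close>
  it becomes \<open>phi0\<close>, which are the two kinds of row added by the steps.
  Moreover \<open>2 * a * row_form b c A + b * Delta a A\<close> is the polarization of \<open>phi0\<close> at the rows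
  \<open>(\<alpha>, \<beta>)\<close> and \<open>(a * \<gamma>, \<delta>)\<close>, and equally that of \<open>phi1\<close> at \<open>(\<gamma>, \<delta>)\<close> and
  \<open>(\<alpha>, a * \<beta>)\<close>; this is how the pairing enters the linear term of the recurrence.
\<close>

definition row_form :: "int \<Rightarrow> int \<Rightarrow> int ^ 2 ^ 2 \<Rightarrow> int" where
  "row_form b c A = A $ 1 $ 1 * A $ 2 $ 1 + b * A $ 1 $ 2 * A $ 2 $ 1 + c * A $ 1 $ 2 * A $ 2 $ 2"

lemma row_form_seq_mat:
  "row_form b c (seq_mat a x m) = (\<Sum>k<m. x (Suc k) * phi a b c k (seq_mat a x k))"
proof (induction m)
  case 0
  show ?case by (simp add: row_form_def)
next
  case (Suc m)
  have "row_form b c (seq_mat a x (Suc m))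
      = row_form b c (seq_mat a x m) + x (Suc m) * phi a b c m (seq_mat a x m)"
    by (simp add: row_form_def phi_def phi0_def phi1_def seq_mat_Suc_entries
        algebra_simps power2_eq_square del: seq_mat.simps)
  with Suc show ?case by simp
qed

text \<open>
  Step \<open>n\<close> fixes the row on which \<open>phi a b c n\<close> depends, so that \<open>phi a b c n\<close> may be computed from
  the matrix after this step; the next step changes this row, and its quadratic form is expanded.
\<close>

lemma phi_seq_mat_Suc_Suc:
  "phi a b c (Suc (Suc n)) (seq_mat a x (Suc (Suc n)))
     = phi a b c n (seq_mat a x n)
       + x (n + 2) * (2 * a * row_form b c (seq_mat a x (Suc n)) + b)
       + a * (x (n + 2))\<^sup>2 * phi a b c (Suc n) (seq_mat a x (Suc n))"
proof -
  let ?A = "seq_mat a x (Suc n)"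
  have fixed: "phi a b c n (seq_mat a x n) = phi a b c n ?A"
    by (simp add: phi_def phi0_def phi1_def seq_mat_Suc_entries del: seq_mat.simps)
  have "phi a b c (Suc (Suc n)) (seq_mat a x (Suc (Suc n)))
      = phi a b c n ?A + x (n + 2) * (2 * a * row_form b c ?A + b * Delta a ?A)
        + a * (x (n + 2))\<^sup>2 * phi a b c (Suc n) ?A"
    by (simp add: phi_def phi0_def phi1_def row_form_def Delta_def step_mat_def
        seq_mat_Suc_entry[of a x "Suc n"] algebra_simps power2_eq_square del: seq_mat.simps)
  then show ?thesis
    by (simp only: fixed Delta_seq_mat mult_1_right)
qed

section \<open>The representation by quadratic forms\<close>

theorem theorem4p6:
  fixes a b c :: int and F :: "int poly" and m :: nat and x :: "nat \<Rightarrow> int"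
  assumes "F = [:c, b, a:]"
  shows "seq_mat a x m \<in> Gamma_set a \<and>
         mpoly_eval x (assoc_mpoly F m) = phi a b c m (seq_mat a x m)"
proof
  show "seq_mat a x m \<in> Gamma_set a"
    by (simp add: Gamma_set_def Delta_seq_mat)
  show "mpoly_eval x (assoc_mpoly F m) = phi a b c m (seq_mat a x m)"
  proof (induction m rule: less_induct)
    case (less m)
    consider "m = 0" | "m = 1" | n where "m = Suc (Suc n)"
      by (metis One_nat_def not0_implies_Suc)
    then show ?case
    proof cases
      case 1
      then show ?thesis
        by (simp add: mpoly_eval_one phi_def phi0_def)
    next
      case 2
      then show ?thesis
        by (simp add: assms mpoly_eval_subst_mpoly mpoly_eval_Var phi_def phi1_def
            map_matrix_def step_mat_def algebra_simps power2_eq_square)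
    next
      case 3
      have "(\<Sum>k<Suc n. x (Suc k) * mpoly_eval x (assoc_mpoly F k))
          = row_form b c (seq_mat a x (Suc n))"
        unfolding row_form_seq_mat by (rule sum.cong) (use 3 less in auto)
      then show ?thesis
        using 3 less[of n] less[of "Suc n"]
        by (simp only: mpoly_eval_assoc_mpoly_Suc_Suc[OF assms] phi_seq_mat_Suc_Suc)
    qed
  qed
qed

end
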